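(* If $M\ge 2$ and $\{\phi_i\}_{i=1}^M$ is a unit norm frame for $\mathbb{H}^N$, then the (optimal) lower Riesz bound of $\{\phi_i\phi_i^*\}_{i=1}^M$ is at most $\dfrac{M(N-1)}{N(M-1)}$.
   Context: $\mathbb{H}$ denotes $\mathbb{R}$ or $\mathbb{C}$, with the usual $\ell_2$ inner product on $\mathbb{H}^N$ (column vectors). $\{\phi_i\}_{i=1}^M\subset\mathbb{H}^N$ is a frame if there are $0<A\le B<\infty$ with $A\|\psi\|^2\le\sum_{i=1}^M|\langle\phi_i,\psi\rangle|^2\le B\|\psi\|^2$ for all $\psi\in\mathbb{H}^N$; unit norm if $\|\phi_i\|=1$ for all $i$. Outer products $\phi\phi^*$ live in $\mathbb{H}^{N\times N}$ with the Frobenius inner product $\langle S,T\rangle_F=\mathrm{Tr}(ST^* )$. The (optimal) lower Riesz bound of a sequence $\{x_i\}_{i=1}^M$ in a finite-dimensional inner product space over $\mathbb{H}$ is the largest $A\ge 0$ such that $A\sum_{i=1}^M|a_i|^2\le\|\sum_{i=1}^M a_ix_i\|^2$ for all scalars $(a_i)\in\mathbb{H}^M$; equivalently, the smallest eigenvalue of its $M\times M$ Gram matrix (it is $0$ if the sequence is dependent). *)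

theory Defs
  imports "HOL-Analysis.Analysis" "Jordan_Normal_Form.Conjugate"
begin

text \<open>
  The scalar field is a type \<open>'h\<close> that is later instantiated to \<^typ>\<open>real\<close>
  (where \<^const>\<open>conjugate\<close> is the identity) and to \<^typ>\<open>complex\<close>
  (where it is \<^const>\<open>cnj\<close>). The space \<open>'h^'n\<close> has dimension \<open>N = CARD('n)\<close>, and
  sequences \<open>x\<^sub>1, \<dots>, x\<^sub>M\<close> are functions on \<^typ>\<open>nat\<close> used only on \<open>{1..M}\<close>.
\<close>

definition l2_inner :: "'h::conjugatable_field ^ 'n \<Rightarrow> 'h ^ 'n \<Rightarrow> 'h" where
  "l2_inner x y = (\<Sum>i\<in>UNIV. x $ i * conjugate (y $ i))"

definition conj_transpose :: "'h::conjugatable_field ^ 'n ^ 'm \<Rightarrow> 'h ^ 'm ^ 'n" where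
  "conj_transpose S = (\<chi> i j. conjugate (S $ j $ i))"

definition frobenius_inner :: "'h::conjugatable_field ^ 'n ^ 'm \<Rightarrow> 'h ^ 'n ^ 'm \<Rightarrow> 'h" where
  "frobenius_inner S T = trace (S ** conj_transpose T)"

definition outer_prod :: "'h::conjugatable_field ^ 'n \<Rightarrow> 'h ^ 'n ^ 'n" where
  "outer_prod \<phi> = columnvector \<phi> ** conj_transpose (columnvector \<phi> :: 'h ^ 1 ^ 'n)"

definition mat_smult :: "'h::times \<Rightarrow> 'h ^ 'n ^ 'm \<Rightarrow> 'h ^ 'n ^ 'm" where
  "mat_smult c S = (\<chi> i j. c * S $ i $ j)"

definition is_frame ::
    "nat \<Rightarrow> (nat \<Rightarrow> 'h::{conjugatable_field, real_normed_field} ^ 'n) \<Rightarrow> bool" where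
  "is_frame M \<phi> \<longleftrightarrow> (\<exists>A B. 0 < A \<and> A \<le> B \<and>
     (\<forall>\<psi>. A * (norm \<psi>)\<^sup>2 \<le> (\<Sum>i\<in>{1..M}. (norm (l2_inner (\<phi> i) \<psi>))\<^sup>2) \<and>
          (\<Sum>i\<in>{1..M}. (norm (l2_inner (\<phi> i) \<psi>))\<^sup>2) \<le> B * (norm \<psi>)\<^sup>2))"

definition unit_norm_frame ::
    "nat \<Rightarrow> (nat \<Rightarrow> 'h::{conjugatable_field, real_normed_field} ^ 'n) \<Rightarrow> bool" where
  "unit_norm_frame M \<phi> \<longleftrightarrow> is_frame M \<phi> \<and> (\<forall>i\<in>{1..M}. norm (\<phi> i) = 1)"

text \<open>
  The scalar multiplication is a parameter, since the library has no type class for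
  normed spaces over \<open>'h\<close>; it is \<^const>\<open>mat_smult\<close> in the case of matrices.
\<close>

definition is_lower_riesz_bound ::
    "('h::real_normed_field \<Rightarrow> 'v::real_normed_vector \<Rightarrow> 'v) \<Rightarrow> nat \<Rightarrow> (nat \<Rightarrow> 'v) \<Rightarrow> real \<Rightarrow> bool"
  where
  "is_lower_riesz_bound smul M x A \<longleftrightarrow> 0 \<le> A \<and>
     (\<forall>a. A * (\<Sum>i\<in>{1..M}. (norm (a i))\<^sup>2) \<le> (norm (\<Sum>i\<in>{1..M}. smul (a i) (x i)))\<^sup>2)"

definition lower_riesz_bound ::
    "('h::real_normed_field \<Rightarrow> 'v::real_normed_vector \<Rightarrow> 'v) \<Rightarrow> nat \<Rightarrow> (nat \<Rightarrow> 'v) \<Rightarrow> real"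
  where
  "lower_riesz_bound smul M x = (GREATEST A. is_lower_riesz_bound smul M x A)"

text \<open>
  The largest lower Riesz bound exists for \<open>M \<ge> 1\<close>, so the \<open>GREATEST\<close> above is meaningful.
\<close>

lemma lower_riesz_bound_greatest:
  fixes smul :: "'h::real_normed_field \<Rightarrow> 'v::real_normed_vector \<Rightarrow> 'v"
  assumes "M \<ge> 1"
  shows "is_lower_riesz_bound smul M x (lower_riesz_bound smul M x)"
    and "is_lower_riesz_bound smul M x A \<Longrightarrow> A \<le> lower_riesz_bound smul M x"
proof -
  let ?P = "is_lower_riesz_bound smul M x"
  let ?c = "\<lambda>a::nat \<Rightarrow> 'h. \<Sum>i\<in>{1..M}. (norm (a i))\<^sup>2"
  let ?r = "\<lambda>a. (norm (\<Sum>i\<in>{1..M}. smul (a i) (x i)))\<^sup>2"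
  have zero: "?P 0"
    by (simp add: is_lower_riesz_bound_def)
  have bdd: "bdd_above (Collect ?P)"
  proof (rule bdd_aboveI)
    fix A assume "A \<in> Collect ?P"
    then have le: "A * ?c a \<le> ?r a" for a
      by (simp add: is_lower_riesz_bound_def)
    have "?c (\<lambda>i. if i = 1 then 1 else 0) = (\<Sum>i\<in>{1..M}. if i = 1 then 1 else 0)"
      by (rule sum.cong) auto
    also have "\<dots> = 1"
      using assms by simp
    finally show "A \<le> ?r (\<lambda>i. if i = 1 then 1 else 0)"
      using le[of "\<lambda>i. if i = 1 then 1 else 0"] by simp
  qed
  have upper: "A \<le> Sup (Collect ?P)" if "?P A" for A
    using bdd that by (auto intro: cSup_upper)
  have Sup: "?P (Sup (Collect ?P))"
    unfolding is_lower_riesz_bound_def[of smul M x "Sup (Collect ?P)"]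
  proof (intro conjI allI)
    show "0 \<le> Sup (Collect ?P)"
      by (rule upper[OF zero])
    fix a
    have nonneg: "?c a \<ge> 0"
      by (intro sum_nonneg) auto
    show "Sup (Collect ?P) * ?c a \<le> ?r a"
    proof (cases "?c a = 0")
      case False
      with nonneg have pos: "?c a > 0" by simp
      have "Sup (Collect ?P) \<le> ?r a / ?c a"
      proof (rule cSup_least)
        show "Collect ?P \<noteq> {}" using zero by auto
        fix A assume "A \<in> Collect ?P"
        then have "A * ?c a \<le> ?r a" by (simp add: is_lower_riesz_bound_def)
        then show "A \<le> ?r a / ?c a" using pos by (simp only: pos_le_divide_eq)
      qed
      then show ?thesis using pos by (simp only: pos_le_divide_eq)
    qed (simp only: mult_zero_right zero_le_power2)
  qed
  have eq: "lower_riesz_bound smul M x = Sup (Collect ?P)"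
    unfolding lower_riesz_bound_def
    using Sup upper by (rule Greatest_equality)
  show "?P (lower_riesz_bound smul M x)"
    and "?P A \<Longrightarrow> A \<le> lower_riesz_bound smul M x"
    using Sup upper by (simp_all only: eq)
qed

text \<open>
  The library norms on \<open>'h^'n\<close> and \<open>'h^'n^'n\<close> are those induced by the two inner products.
\<close>

lemma l2_inner_self_real: "l2_inner (x :: real ^ 'n) x = (norm x)\<^sup>2"
  by (simp add: l2_inner_def norm_vec_def L2_set_def sum_nonneg power2_eq_square)

lemma l2_inner_self_complex: "l2_inner (x :: complex ^ 'n) x = complex_of_real ((norm x)\<^sup>2)"
  by (simp add: l2_inner_def norm_vec_def L2_set_def sum_nonneg
      complex_norm_square[symmetric] flip: of_real_power of_real_sum)

lemma frobenius_inner_self_real: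
  "frobenius_inner (S :: real ^ 'n ^ 'm) S = (norm S)\<^sup>2"
  by (simp add: frobenius_inner_def trace_def matrix_matrix_mult_def conj_transpose_def
      norm_vec_def L2_set_def sum_nonneg power2_eq_square)

lemma frobenius_inner_self_complex:
  "frobenius_inner (S :: complex ^ 'n ^ 'm) S = complex_of_real ((norm S)\<^sup>2)"
  by (simp add: frobenius_inner_def trace_def matrix_matrix_mult_def conj_transpose_def
      norm_vec_def L2_set_def sum_nonneg
      complex_norm_square[symmetric] flip: of_real_power of_real_sum)

lemma outer_prod_nth: "outer_prod \<phi> $ i $ j = \<phi> $ i * conjugate (\<phi> $ j)"
  by (simp add: outer_prod_def columnvector_def matrix_matrix_mult_def conj_transpose_def)

end

theory Submission
  imports Defs
begin

text \<open>
  A lower Riesz bound \<open>A\<close> of \<open>x\<^sub>1, \<dots>, x\<^sub>M\<close> is tested on the coefficient vectors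
  \<open>e\<^sub>k - (1/M) (1, \<dots>, 1)\<close>, the projections of the standard basis onto the orthogonal
  complement of \<open>(1, \<dots>, 1)\<close>. They synthesize the deviations \<open>x\<^sub>k - m\<close> from the mean \<open>m\<close>,
  so summing over \<open>k\<close> gives
  \<open>A (M - 1) \<le> \<Sum>\<^sub>k \<parallel>x\<^sub>k - m\<parallel>\<^sup>2 = \<Sum>\<^sub>k \<parallel>x\<^sub>k\<parallel>\<^sup>2 - \<parallel>\<Sum>\<^sub>k x\<^sub>k\<parallel>\<^sup>2/M\<close> (\<open>lower_riesz_bound_variance\<close>).
  In terms of the Gram matrix, the smallest eigenvalue is at most the average of the
  quadratic form over the hyperplane orthogonal to \<open>(1, \<dots>, 1)\<close>.

  For \<open>x\<^sub>k = \<phi>\<^sub>k \<phi>\<^sub>k\<^sup>*\<close> with unit vectors \<open>\<phi>\<^sub>k\<close>, each \<open>x\<^sub>k\<close> has norm one and trace one, so the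
  frame operator \<open>S = \<Sum>\<^sub>k x\<^sub>k\<close> has trace \<open>M\<close>. Cauchy-Schwarz against the identity
  (\<open>norm_trace_le\<close>) gives \<open>\<parallel>S\<parallel>\<^sup>2 \<ge> M\<^sup>2/N\<close>. Hence \<open>A (M - 1) \<le> M - M/N\<close>, which is the claim.
\<close>

lemma sum_norm_deviation_from_mean:
  fixes x :: "'i \<Rightarrow> 'v::real_inner"
  assumes "finite I" and "I \<noteq> {}"
  shows "(\<Sum>k\<in>I. (norm (x k - (1 / real (card I)) *\<^sub>R sum x I))\<^sup>2)
           = (\<Sum>k\<in>I. (norm (x k))\<^sup>2) - (norm (sum x I))\<^sup>2 / real (card I)"
proof -
  define c where "c = 1 / real (card I)"
  define s where "s = sum x I"
  have c: "real (card I) * c = 1"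
    using assms by (simp add: c_def)
  have "(\<Sum>k\<in>I. (norm (x k - c *\<^sub>R s))\<^sup>2)
          = (\<Sum>k\<in>I. (norm (x k))\<^sup>2 - 2 * c * (x k \<bullet> s) + c\<^sup>2 * (norm s)\<^sup>2)"
    unfolding power2_norm_eq_inner
    by (intro sum.cong refl)
      (simp add: inner_diff inner_commute power2_eq_square algebra_simps)
  also have "\<dots> = (\<Sum>k\<in>I. (norm (x k))\<^sup>2) - 2 * c * (norm s)\<^sup>2
                   + (real (card I) * c) * c * (norm s)\<^sup>2"
    by (simp add: sum.distrib sum_subtractf dot_square_norm power2_eq_square
        flip: sum_distrib_left inner_sum_left s_def)
  also have "\<dots> = (\<Sum>k\<in>I. (norm (x k))\<^sup>2) - c * (norm s)\<^sup>2"
    by (simp add: c)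
  finally show ?thesis
    by (simp add: c_def s_def)
qed

text \<open>
  The squared norm of \<open>e\<^sub>k - (1/M) (1, \<dots>, 1)\<close> is \<open>1 - 1/M\<close>; summed over \<open>k\<close> this gives the
  factor \<open>M - 1\<close>.
\<close>

lemma lower_riesz_bound_variance:
  fixes smul :: "'h::real_normed_field \<Rightarrow> 'v::real_inner \<Rightarrow> 'v"
  assumes smul: "\<And>c v. smul (of_real c) v = c *\<^sub>R v"
    and M: "M \<ge> 1"
    and A: "is_lower_riesz_bound smul M x A"
  shows "A * (real M - 1)
           \<le> (\<Sum>k\<in>{1..M}. (norm (x k))\<^sup>2) - (norm (\<Sum>k\<in>{1..M}. x k))\<^sup>2 / real M"
proof -
  define a :: "nat \<Rightarrow> nat \<Rightarrow> real" where "a k i = of_bool (i = k) - 1 / real M" for k i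
  have norm_a: "(\<Sum>i\<in>{1..M}. (a k i)\<^sup>2) = 1 - 1 / real M" if "k \<in> {1..M}" for k
    \<comment> \<open>the scalar instance of the variance identity, for the indicator of \<open>k\<close>\<close>
    using sum_norm_deviation_from_mean[of "{1..M}" "\<lambda>i. of_bool (i = k) :: real"] M that
    by (simp add: a_def if_distrib[of "\<lambda>t. t\<^sup>2"] of_bool_def cong: if_cong)
  have synth: "(\<Sum>i\<in>{1..M}. smul (of_real (a k i)) (x i))
                 = x k - (1 / real M) *\<^sub>R (\<Sum>i\<in>{1..M}. x i)" if "k \<in> {1..M}" for k
  proof -
    have "(\<Sum>i\<in>{1..M}. smul (of_real (a k i)) (x i))
            = (\<Sum>i\<in>{1..M}. (if i = k then x i else 0) - (1 / real M) *\<^sub>R x i)"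
      unfolding smul a_def by (intro sum.cong refl) (simp add: algebra_simps)
    also have "\<dots> = x k - (1 / real M) *\<^sub>R (\<Sum>i\<in>{1..M}. x i)"
      using that by (simp add: sum_subtractf scaleR_sum_right)
    finally show ?thesis .
  qed
  have "A * (real M - 1) = (\<Sum>k\<in>{1..M}. A * (\<Sum>i\<in>{1..M}. (a k i)\<^sup>2))"
  proof -
    have "(\<Sum>k\<in>{1..M}. A * (\<Sum>i\<in>{1..M}. (a k i)\<^sup>2)) = (\<Sum>k\<in>{1..M}. A * (1 - 1 / real M))"
      using norm_a by (intro sum.cong) simp_all
    also have "\<dots> = A * (real M - 1)"
      using M by (simp add: field_simps)
    finally show ?thesis by simp
  qed
  also have "\<dots> \<le> (\<Sum>k\<in>{1..M}. (norm (x k - (1 / real M) *\<^sub>R (\<Sum>i\<in>{1..M}. x i)))\<^sup>2)"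
  proof (rule sum_mono)
    fix k assume k: "k \<in> {1..M}"
    have "A * (\<Sum>i\<in>{1..M}. (norm (of_real (a k i) :: 'h))\<^sup>2)
            \<le> (norm (\<Sum>i\<in>{1..M}. smul (of_real (a k i)) (x i)))\<^sup>2"
      using A[unfolded is_lower_riesz_bound_def, THEN conjunct2, THEN spec,
          of "\<lambda>i. of_real (a k i)"] .
    then show "A * (\<Sum>i\<in>{1..M}. (a k i)\<^sup>2)
                 \<le> (norm (x k - (1 / real M) *\<^sub>R (\<Sum>i\<in>{1..M}. x i)))\<^sup>2"
      by (simp only: synth[OF k] norm_of_real power2_abs)
  qed
  also have "\<dots> = (\<Sum>k\<in>{1..M}. (norm (x k))\<^sup>2) - (norm (\<Sum>k\<in>{1..M}. x k))\<^sup>2 / real M"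
    using sum_norm_deviation_from_mean[of "{1..M}" x] M by simp
  finally show ?thesis .
qed

lemma norm_vec_squared:
  fixes x :: "'a::real_normed_vector ^ 'n"
  shows "(norm x)\<^sup>2 = (\<Sum>i\<in>UNIV. (norm (x $ i))\<^sup>2)"
  by (simp add: norm_vec_def L2_set_def sum_nonneg)

text \<open>
  This is the Cauchy-Schwarz inequality for the Frobenius inner product of \<open>S\<close> with the
  identity matrix, whose squared norm is \<open>N\<close>.
\<close>

lemma norm_trace_le:
  fixes S :: "'h::real_normed_field ^ 'n ^ 'n"
  shows "(norm (trace S))\<^sup>2 \<le> real CARD('n) * (norm S)\<^sup>2"
proof -
  have "norm (trace S) \<le> (\<Sum>i\<in>UNIV. norm (S $ i $ i))"
    unfolding trace_def by (rule norm_sum)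
  then have "(norm (trace S))\<^sup>2 \<le> (\<Sum>i\<in>UNIV. norm (S $ i $ i))\<^sup>2"
    by (simp add: power_mono)
  also have "\<dots> \<le> real CARD('n) * (\<Sum>i\<in>UNIV. (norm (S $ i $ i))\<^sup>2)"
    using sum_squared_le_sum_of_squares[of "\<lambda>i. norm (S $ i $ i)" "UNIV :: 'n set"]
    by (simp add: mult.commute)
  also have "\<dots> \<le> real CARD('n) * (norm S)\<^sup>2"
  proof (rule mult_left_mono)
    show "(\<Sum>i\<in>UNIV. (norm (S $ i $ i))\<^sup>2) \<le> (norm S)\<^sup>2"
      unfolding norm_vec_squared[of S]
      by (intro sum_mono power_mono Finite_Cartesian_Product.norm_nth_le norm_ge_zero)
  qed simp
  finally show ?thesis .
qed

lemma trace_outer_prod: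
  fixes \<phi> :: "'h::{conjugatable_field, real_normed_field} ^ 'n"
  assumes conj: "\<And>z::'h. z * conjugate z = of_real ((norm z)\<^sup>2)"
  shows "trace (outer_prod \<phi>) = of_real ((norm \<phi>)\<^sup>2)"
  by (simp add: trace_def outer_prod_nth conj norm_vec_squared)

lemma norm_outer_prod:
  fixes \<phi> :: "'h::{conjugatable_field, real_normed_field} ^ 'n"
  assumes conj: "\<And>z::'h. z * conjugate z = of_real ((norm z)\<^sup>2)"
  shows "norm (outer_prod \<phi>) = (norm \<phi>)\<^sup>2"
proof -
  have norm_conj: "norm (conjugate z) = norm z" for z :: 'h
  proof (cases "z = 0")
    case False
    have "norm z * norm (conjugate z) = norm z * norm z"
      using arg_cong[OF conj[of z], of norm] by (simp add: norm_mult power2_eq_square)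
    with False show ?thesis by simp
  qed simp
  have "(norm (outer_prod \<phi>))\<^sup>2 = ((norm \<phi>)\<^sup>2)\<^sup>2"
    unfolding norm_vec_squared outer_prod_nth norm_mult norm_conj power_mult_distrib
    by (simp add: power2_eq_square[of "sum _ _"] sum_product)
  then show ?thesis
    by (rule power2_eq_imp_eq) simp_all
qed

text \<open>
  The real and the complex case share one proof: of the scalars it needs a norm that comes
  from a real inner product and satisfies \<open>z z\<^sup>* = |z|\<^sup>2\<close>.
\<close>

lemma lower_riesz_bound_outer_prod_le:
  fixes \<phi> :: "nat \<Rightarrow> 'h::{conjugatable_field, real_normed_field, real_inner} ^ 'n"
  assumes conj: "\<And>z::'h. z * conjugate z = of_real ((norm z)\<^sup>2)"
    and M: "M \<ge> 2"
    and unit: "\<And>i. i \<in> {1..M} \<Longrightarrow> norm (\<phi> i) = 1"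
  shows "lower_riesz_bound (mat_smult :: 'h \<Rightarrow> _) M (\<lambda>i. outer_prod (\<phi> i))
           \<le> real M * (real CARD('n) - 1) / (real CARD('n) * (real M - 1))"
proof -
  let ?N = "real CARD('n)"
  let ?x = "\<lambda>i. outer_prod (\<phi> i)"
  define A where "A = lower_riesz_bound (mat_smult :: 'h \<Rightarrow> _) M ?x"
  define S where "S = (\<Sum>i\<in>{1..M}. ?x i)"
  have smult: "mat_smult (of_real c :: 'h) T = c *\<^sub>R T" for c and T :: "'h ^ 'n ^ 'n"
    by (simp add: mat_smult_def vec_eq_iff scaleR_conv_of_real[where 'a = 'h])
  have "trace S = (\<Sum>i\<in>{1..M}. trace (?x i))"
    unfolding S_def trace_def sum_component by (rule sum.swap)
  also have "\<dots> = of_nat M"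
    by (simp add: trace_outer_prod[OF conj] unit)
  finally have "(real M)\<^sup>2 \<le> ?N * (norm S)\<^sup>2"
    using norm_trace_le[of S] by simp
  then have S: "real M / ?N \<le> (norm S)\<^sup>2 / real M"
    using M by (simp add: field_simps power2_eq_square)
  have "is_lower_riesz_bound mat_smult M ?x A"
    unfolding A_def using M by (intro lower_riesz_bound_greatest) simp
  from lower_riesz_bound_variance[OF smult _ this] M
  have "A * (real M - 1) \<le> (\<Sum>i\<in>{1..M}. (norm (?x i))\<^sup>2) - (norm S)\<^sup>2 / real M"
    by (simp add: S_def)
  also have "\<dots> = real M - (norm S)\<^sup>2 / real M"
    by (simp add: norm_outer_prod[OF conj] unit)
  also have "\<dots> \<le> real M * (?N - 1) / ?N"
    using S by (simp add: field_simps)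
  finally have "A * (real M - 1) \<le> real M * (?N - 1) / ?N" .
  then have "A \<le> real M * (?N - 1) / ?N / (real M - 1)"
    using M by (simp only: pos_le_divide_eq)
  then show ?thesis
    by (simp add: A_def)
qed

theorem theorem4p5:
  fixes M :: nat
  assumes "M \<ge> 2"
  shows "(\<forall>\<phi> :: nat \<Rightarrow> real ^ 'n. unit_norm_frame M \<phi> \<longrightarrow>
            lower_riesz_bound (mat_smult :: real \<Rightarrow> _) M (\<lambda>i. outer_prod (\<phi> i))
              \<le> real M * (real CARD('n) - 1) / (real CARD('n) * (real M - 1)))
       \<and> (\<forall>\<phi> :: nat \<Rightarrow> complex ^ 'n. unit_norm_frame M \<phi> \<longrightarrow>
            lower_riesz_bound (mat_smult :: complex \<Rightarrow> _) M (\<lambda>i. outer_prod (\<phi> i))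
              \<le> real M * (real CARD('n) - 1) / (real CARD('n) * (real M - 1)))"
proof (intro conjI allI impI)
  fix \<phi> :: "nat \<Rightarrow> real ^ 'n"
  assume "unit_norm_frame M \<phi>"
  then show "lower_riesz_bound (mat_smult :: real \<Rightarrow> _) M (\<lambda>i. outer_prod (\<phi> i))
               \<le> real M * (real CARD('n) - 1) / (real CARD('n) * (real M - 1))"
    using assms
    by (intro lower_riesz_bound_outer_prod_le) (auto simp: unit_norm_frame_def power2_eq_square)
next
  fix \<phi> :: "nat \<Rightarrow> complex ^ 'n"
  assume "unit_norm_frame M \<phi>"
  then show "lower_riesz_bound (mat_smult :: complex \<Rightarrow> _) M (\<lambda>i. outer_prod (\<phi> i))
               \<le> real M * (real CARD('n) - 1) / (real CARD('n) * (real M - 1))"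
    using assms
    by (intro lower_riesz_bound_outer_prod_le)
      (auto simp: unit_norm_frame_def simp flip: complex_norm_square simp del: of_real_power)
qed

end
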